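(* Let $\ell\ge4$ be an even integer and let $0\le t\le\ell$. Let $C$ be an oriented cycle obtained by reversing the orientation of $t$ edges of the directed cycle $C_\ell$. (i) If $\ell\equiv0\pmod4$ and $t$ is even, or $\ell\equiv2\pmod4$ and $t$ is odd, then $C$ is not locally tournament anti-Sidorenko (LTAS). (ii) If $\ell\equiv0\pmod4$ and $t$ is odd, or $\ell\equiv2\pmod4$ and $t$ is even, then $C$ is not locally tournament Sidorenko (LTS).
   Context: $C_\ell$ is the cycle of length $\ell$ with all edges oriented clockwise. A weighted tournament on $n$ vertices is a function $A:[n]^2\to[0,1]$ with $A(x,y)+A(y,x)=1$ for all $x,y$ (so $A(x,x)=1/2$). For a digraph $D$, $t_D(A)=n^{-v(D)}\sum_{\phi:V(D)\to[n]}\prod_{(x,y)\in E(D)}A(\phi(x),\phi(y))$. Write $A=\frac12J+B$ with $J$ the all-ones matrix and $B$ skew-symmetric, and let $\lambda_{\max}(B)$ be the largest modulus of an eigenvalue of $B$. $D$ is LTS if there is $\varepsilon=\varepsilon(D)>0$ such that for every $n$ and every weighted tournament $A=\frac12J+B$ on $n$ vertices with $\lambda_{\max}(B)\le\varepsilon n$ one has $t_D(A)\ge2^{-e(D)}$; it is LTAS if there is such an $\varepsilon$ with $t_D(A)\le2^{-e(D)}$ for all such $A$. *)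

theory Defs
  imports
    "Jordan_Normal_Form.Spectral_Radius"
    "Graph_Theory.Pair_Digraph"
begin

text \<open>The vertex set \<open>[n]\<close> of a weighted tournament is rendered as \<open>{0..<n}\<close>, the index range of
  \<open>n \<times> n\<close> matrices.\<close>

definition weighted_tournament :: "nat \<Rightarrow> real mat \<Rightarrow> bool" where
  "weighted_tournament n A \<longleftrightarrow> A \<in> carrier_mat n n \<and>
     (\<forall>x<n. \<forall>y<n. 0 \<le> A $$ (x, y) \<and> A $$ (x, y) \<le> 1 \<and> A $$ (x, y) + A $$ (y, x) = 1)"

definition hom_density :: "'a pair_pre_digraph \<Rightarrow> nat \<Rightarrow> real mat \<Rightarrow> real" where
  "hom_density D n A =
     (\<Sum>\<phi> \<in> PiE (pverts D) (\<lambda>_. {0..<n}). \<Prod>(x, y)\<in>parcs D. A $$ (\<phi> x, \<phi> y))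
       / real n ^ card (pverts D)"

definition all_ones_mat :: "nat \<Rightarrow> real mat" where
  "all_ones_mat n = mat n n (\<lambda>_. 1)"

definition skew_part :: "nat \<Rightarrow> real mat \<Rightarrow> real mat" where
  "skew_part n A = A - (1 / 2) \<cdot>\<^sub>m all_ones_mat n"

text \<open>The eigenvalues of a real skew-symmetric matrix are purely imaginary, so they are taken over
  the complex numbers.\<close>

definition lambda_max :: "real mat \<Rightarrow> real" where
  "lambda_max B = spectral_radius (map_mat complex_of_real B)"

text \<open>Both definitions ask for \<open>n > 0\<close>: for \<open>n = 0\<close> neither the density (a division by zero) nor the
  maximum over the empty spectrum is meaningful.\<close>

definition LTS :: "'a pair_pre_digraph \<Rightarrow> bool" where
  "LTS D \<longleftrightarrow> (\<exists>\<epsilon>>0. \<forall>n>0. \<forall>A. weighted_tournament n A \<longrightarrow>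
     lambda_max (skew_part n A) \<le> \<epsilon> * real n \<longrightarrow>
     hom_density D n A \<ge> 1 / 2 ^ card (parcs D))"

definition LTAS :: "'a pair_pre_digraph \<Rightarrow> bool" where
  "LTAS D \<longleftrightarrow> (\<exists>\<epsilon>>0. \<forall>n>0. \<forall>A. weighted_tournament n A \<longrightarrow>
     lambda_max (skew_part n A) \<le> \<epsilon> * real n \<longrightarrow>
     hom_density D n A \<le> 1 / 2 ^ card (parcs D))"

definition directed_cycle :: "nat \<Rightarrow> nat pair_pre_digraph" where
  "directed_cycle l = \<lparr> pverts = {0..<l}, parcs = {(i, (i + 1) mod l) | i. i < l} \<rparr>"

definition reverse_arcs :: "('a \<times> 'a) set \<Rightarrow> 'a pair_pre_digraph \<Rightarrow> 'a pair_pre_digraph" where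
  "reverse_arcs S D = \<lparr> pverts = pverts D, parcs = (parcs D - S) \<union> S\<inverse> \<rparr>"

end

theory Submission
  imports Defs
begin

text \<open>Perturb \<open>J/2\<close> by \<open>d b\<close>, where \<open>b\<close> is the skew adjacency matrix of the cyclic triangle.
  Since \<open>b\<close> has vanishing row and column sums, \<open>J b = b J = 0\<close>, so the homomorphism count of an
  oriented cycle, which is the trace of a product of factors \<open>J/2 \<plusminus> d b\<close>, collapses to
  \<open>tr ((J/2)^l) + (-1)^t d^l tr (b^l)\<close>. As \<open>b^2 = J - 3I\<close>, one has \<open>tr (b^(2m)) = 2 (-3)^m\<close>, which
  determines the sign of the deviation for arbitrarily small \<open>d > 0\<close>.\<close>

section \<open>Transfer matrices\<close>

text \<open>Entry \<open>(x, y)\<close> of the ordered product of the \<open>n\<close> by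
  \<open>n\<close> matrices \<open>M 0\<close>, ..., \<open>M (k - 1)\<close>. The factor depends on
  its position because each arc of the cycle has its own orientation.\<close>

fun walk_sum :: "nat \<Rightarrow> (nat \<Rightarrow> nat \<Rightarrow> nat \<Rightarrow> 'a::comm_ring_1) \<Rightarrow> nat \<Rightarrow> nat \<Rightarrow> nat \<Rightarrow> 'a" where
  "walk_sum n M 0 x y = of_bool (x = y)"
| "walk_sum n M (Suc k) x y = (\<Sum>z<n. walk_sum n M k x z * M k z y)"

lemma sum_PiE_Suc:
  fixes F :: "(nat \<Rightarrow> 'b) \<Rightarrow> 'a::comm_monoid_add"
  shows "(\<Sum>\<phi> \<in> PiE {0..<Suc k} (\<lambda>_. N). F \<phi>) =
         (\<Sum>\<phi> \<in> PiE {0..<k} (\<lambda>_. N). \<Sum>y\<in>N. F (\<phi>(k := y)))"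
proof -
  have inj: "inj_on (\<lambda>(y, \<phi>). \<phi>(k := y)) (N \<times> PiE {0..<k} (\<lambda>_. N))"
    by (rule inj_combinator) simp
  have "(\<Sum>\<phi> \<in> PiE {0..<Suc k} (\<lambda>_. N). F \<phi>) =
        (\<Sum>(y, \<phi>) \<in> N \<times> PiE {0..<k} (\<lambda>_. N). F (\<phi>(k := y)))"
    unfolding atLeast0_lessThan_Suc PiE_insert_eq sum.reindex[OF inj]
    by (simp add: case_prod_unfold o_def)
  also have "\<dots> = (\<Sum>y\<in>N. \<Sum>\<phi> \<in> PiE {0..<k} (\<lambda>_. N). F (\<phi>(k := y)))"
    by (rule sum.cartesian_product[symmetric])
  also have "\<dots> = (\<Sum>\<phi> \<in> PiE {0..<k} (\<lambda>_. N). \<Sum>y\<in>N. F (\<phi>(k := y)))"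
    by (rule sum.swap)
  finally show ?thesis .
qed

text \<open>The weight \<open>g\<close> on the two endpoints is left arbitrary so that the induction
  can absorb the factor of the last arc into it.\<close>

lemma sum_PiE_path:
  fixes M :: "nat \<Rightarrow> nat \<Rightarrow> nat \<Rightarrow> 'a::comm_ring_1"
  shows "(\<Sum>\<phi> \<in> PiE {0..<Suc k} (\<lambda>_. {0..<n}).
            (\<Prod>i<k. M i (\<phi> i) (\<phi> (Suc i))) * g (\<phi> 0) (\<phi> k)) =
         (\<Sum>x<n. \<Sum>y<n. walk_sum n M k x y * g x y)"
proof (induction k arbitrary: g)
  case 0
  have "(\<Sum>y<n. of_bool (x = y) * g x y) = g x x" if "x < n" for x
    using that by (simp add: of_bool_def if_distrib[of "\<lambda>c. c * _"] cong: if_cong)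
  then show ?case
    unfolding sum_PiE_Suc by (simp add: atLeast0LessThan)
next
  case (Suc k)
  have "(\<Sum>\<phi> \<in> PiE {0..<Suc (Suc k)} (\<lambda>_. {0..<n}).
            (\<Prod>i<Suc k. M i (\<phi> i) (\<phi> (Suc i))) * g (\<phi> 0) (\<phi> (Suc k))) =
        (\<Sum>\<phi> \<in> PiE {0..<Suc k} (\<lambda>_. {0..<n}).
            (\<Prod>i<k. M i (\<phi> i) (\<phi> (Suc i))) * (\<Sum>y<n. M k (\<phi> k) y * g (\<phi> 0) y))"
    unfolding sum_PiE_Suc[where k = "Suc k"]
    by (simp add: sum_distrib_left mult.assoc atLeast0LessThan)
  also have "\<dots> = (\<Sum>x<n. \<Sum>z<n. walk_sum n M k x z * (\<Sum>y<n. M k z y * g x y))"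
    by (rule Suc.IH)
  also have "\<dots> = (\<Sum>x<n. \<Sum>y<n. \<Sum>z<n. walk_sum n M k x z * (M k z y * g x y))"
    unfolding sum_distrib_left by (intro sum.cong refl sum.swap)
  also have "\<dots> = (\<Sum>x<n. \<Sum>y<n. walk_sum n M (Suc k) x y * g x y)"
    by (simp add: sum_distrib_right mult.assoc)
  finally show ?case .
qed

lemma sum_PiE_cycle:
  fixes M :: "nat \<Rightarrow> nat \<Rightarrow> nat \<Rightarrow> 'a::comm_ring_1"
  assumes "l > 0"
  shows "(\<Sum>\<phi> \<in> PiE {0..<l} (\<lambda>_. {0..<n}). \<Prod>i<l. M i (\<phi> i) (\<phi> (Suc i mod l))) =
         (\<Sum>x<n. walk_sum n M l x x)"
proof -
  obtain m where l: "l = Suc m"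
    using assms gr0_implies_Suc by blast
  have "(\<Prod>i<l. M i (\<phi> i) (\<phi> (Suc i mod l))) =
        (\<Prod>i<m. M i (\<phi> i) (\<phi> (Suc i))) * M m (\<phi> m) (\<phi> 0)" for \<phi>
    by (simp add: l)
  \<comment> \<open>With the factor of the closing arc as endpoint weight, the path sum becomes the
    trace of the full product.\<close>
  then show ?thesis
    using sum_PiE_path[where M = M and k = m and n = n and g = "\<lambda>x y. M m y x"] by (simp add: l)
qed

section \<open>Oriented cycles\<close>

definition oriented_arc :: "nat \<Rightarrow> (nat \<times> nat) set \<Rightarrow> nat \<Rightarrow> nat \<times> nat" where
  "oriented_arc l S i =
     (if (i, Suc i mod l) \<in> S then (Suc i mod l, i) else (i, Suc i mod l))"

text \<open>Arcs correspond to positions, so products over the arc set become products over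
  \<open>{..<l}\<close>. For \<open>l = 2\<close>, reversing one arc would merge it with the
  other.\<close>

lemma bij_betw_oriented_arc:
  assumes "l \<ge> 3" and S: "S \<subseteq> parcs (directed_cycle l)"
  shows "bij_betw (oriented_arc l S) {..<l} (parcs (reverse_arcs S (directed_cycle l)))"
proof -
  have "inj_on (oriented_arc l S) {..<l}"
  proof (rule inj_onI)
    fix i j assume "i \<in> {..<l}" "j \<in> {..<l}" and eq: "oriented_arc l S i = oriented_arc l S j"
    then have "i < l" "j < l" by auto
    \<comment> \<open>In the second case \<open>i\<close> would equal \<open>i + 2\<close> modulo
      \<open>l\<close>, impossible for \<open>l \<ge> 3\<close>.\<close>
    have "i = j \<or> (i = Suc j mod l \<and> j = Suc i mod l)"
      using eq by (auto simp: oriented_arc_def split: if_splits)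
    then show "i = j"
      using \<open>i < l\<close> \<open>j < l\<close> assms(1) by (auto simp: mod_Suc split: if_splits)
  qed
  moreover have "oriented_arc l S ` {..<l} = parcs (reverse_arcs S (directed_cycle l))"
    using S by (force simp: oriented_arc_def reverse_arcs_def directed_cycle_def)
  ultimately show ?thesis
    by (simp add: bij_betw_def)
qed

text \<open>Reversing an arc transposes its factor, which flips the sign of the skew part; these
  signs multiply up here.\<close>

lemma prod_sign_reversed_arcs:
  assumes S: "S \<subseteq> parcs (directed_cycle l)"
  shows "(\<Prod>i<l. if (i, Suc i mod l) \<in> S then - 1 else 1) = (- 1 :: 'a::comm_ring_1) ^ card S"
proof -
  let ?I = "{i. i < l \<and> (i, Suc i mod l) \<in> S}"
  have "bij_betw (\<lambda>i. (i, Suc i mod l)) ?I S"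
    using S by (force simp: bij_betw_def inj_on_def directed_cycle_def)
  then have "card ?I = card S"
    by (rule bij_betw_same_card)
  moreover have "(\<Prod>i<l. if (i, Suc i mod l) \<in> S then - 1 else (1::'a)) = (- 1) ^ card ?I"
    by (simp add: prod.If_cases Int_def)
  ultimately show ?thesis by simp
qed

lemma hom_density_oriented_cycle:
  assumes "l \<ge> 3" and "S \<subseteq> parcs (directed_cycle l)"
  shows "hom_density (reverse_arcs S (directed_cycle l)) n A =
    (\<Sum>x<n. walk_sum n
       (\<lambda>i x y. if (i, Suc i mod l) \<in> S then A $$ (y, x) else A $$ (x, y)) l x x) / real n ^ l"
proof -
  let ?C = "reverse_arcs S (directed_cycle l)"
  have "pverts ?C = {0..<l}"
    by (simp add: reverse_arcs_def directed_cycle_def)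
  moreover have "(\<Prod>(x, y)\<in>parcs ?C. A $$ (\<phi> x, \<phi> y)) =
      (\<Prod>i<l. if (i, Suc i mod l) \<in> S then A $$ (\<phi> (Suc i mod l), \<phi> i)
              else A $$ (\<phi> i, \<phi> (Suc i mod l)))" for \<phi>
    by (subst prod.reindex_bij_betw[OF bij_betw_oriented_arc[OF assms], symmetric])
       (auto simp: oriented_arc_def intro!: prod.cong)
  moreover note sum_PiE_cycle[where l = l and n = n and
     M = "\<lambda>i x y. if (i, Suc i mod l) \<in> S then A $$ (y, x) else A $$ (x, y)"]
  ultimately show ?thesis
    using assms(1) by (simp add: hom_density_def)
qed

section \<open>The perturbed cyclic triangle\<close>

definition cyclic_skew :: "nat \<Rightarrow> nat \<Rightarrow> real" where
  "cyclic_skew x y = (if x = y then 0 else if y = Suc x mod 3 then 1 else - 1)"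

definition cyclic_tournament :: "real \<Rightarrow> real mat" where
  "cyclic_tournament d = mat 3 3 (\<lambda>(x, y). 1 / 2 + d * cyclic_skew x y)"

lemma less_3_cases: "x = 0 \<or> x = 1 \<or> x = 2" if "x < 3" for x :: nat
  using that by linarith

lemma sum_lessThan_3: "(\<Sum>z<3. f z) = f 0 + f 1 + f (2::nat)" for f :: "nat \<Rightarrow> 'a::comm_monoid_add"
  by (simp add: numeral_3_eq_3 numeral_2_eq_2)

lemma cyclic_skew_antisym: "x < 3 \<Longrightarrow> y < 3 \<Longrightarrow> cyclic_skew y x = - cyclic_skew x y"
  by (drule less_3_cases, drule less_3_cases, elim disjE; simp add: cyclic_skew_def)

lemma abs_cyclic_skew_le: "\<bar>cyclic_skew x y\<bar> \<le> 1"
  by (simp add: cyclic_skew_def)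

text \<open>With \<open>b\<close> for \<open>cyclic_skew\<close>, the function
  \<open>if x = y then - 2 else 1\<close> is the matrix \<open>J - 3I\<close>. The facts are, in
  order: \<open>b\<close> has zero row sums and zero column sums, \<open>b^2 = J - 3I\<close>, this
  matrix has zero row sums, and its product with \<open>b\<close> is \<open>-3b\<close>.\<close>

lemma cyclic_skew_sums:
  assumes "x < 3" "y < 3"
  shows "(\<Sum>z<3. cyclic_skew x z) = 0"
    and "(\<Sum>z<3. cyclic_skew z y) = 0"
    and "(\<Sum>z<3. cyclic_skew x z * cyclic_skew z y) = (if x = y then - 2 else 1)"
    and "(\<Sum>z<3. if x = z then - 2 else 1 :: real) = 0"
    and "(\<Sum>z<3. (if x = z then - 2 else 1) * cyclic_skew z y) = - 3 * cyclic_skew x y"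
  using less_3_cases[OF assms(1)] less_3_cases[OF assms(2)]
  by (elim disjE; simp add: sum_lessThan_3 cyclic_skew_def)+

text \<open>The cross terms involve only a row sum of the left factor and a column sum of the right
  one, so they vanish for the matrices above.\<close>

lemma sum_affine_mult:
  fixes f g :: "nat \<Rightarrow> real"
  shows "(\<Sum>z<n. (q + p * f z) * (c + r * g z)) =
    real n * (q * c) + p * c * (\<Sum>z<n. f z) + q * r * (\<Sum>z<n. g z) + p * r * (\<Sum>z<n. f z * g z)"
  by (induction n) (simp_all add: algebra_simps)

lemma weighted_tournament_cyclic:
  assumes "0 \<le> d" "d \<le> 1 / 2"
  shows "weighted_tournament 3 (cyclic_tournament d)"
proof -
  have "0 \<le> 1 / 2 + d * cyclic_skew x y" "1 / 2 + d * cyclic_skew x y \<le> 1" for x y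
    using assms by (auto simp: cyclic_skew_def)
  moreover have "1 / 2 + d * cyclic_skew x y + (1 / 2 + d * cyclic_skew y x) = 1"
    if "x < 3" "y < 3" for x y
    using cyclic_skew_antisym[OF that] by simp
  ultimately show ?thesis
    by (simp add: weighted_tournament_def cyclic_tournament_def)
qed

text \<open>Without cross terms, a product of \<open>k \<ge> 1\<close> factors is
  \<open>(J/2)^k\<close> plus the signed multiple of \<open>d^k b^k\<close>. Since
  \<open>b^3 = -3b\<close>, odd powers of \<open>b\<close> are multiples of \<open>b\<close> and
  even ones of \<open>J - 3I\<close>, hence the two formulas.\<close>

lemma walk_sum_cyclic:
  fixes s :: "nat \<Rightarrow> real" and M :: "nat \<Rightarrow> nat \<Rightarrow> nat \<Rightarrow> real"
  assumes M: "\<And>i x y. x < 3 \<Longrightarrow> y < 3 \<Longrightarrow> M i x y = 1 / 2 + s i * d * cyclic_skew x y"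
    and "x < 3" "y < 3"
  shows "walk_sum 3 M (2 * m + 1) x y =
           3 ^ (2 * m) / 2 ^ (2 * m + 1)
           + (\<Prod>i<2 * m + 1. s i) * d ^ (2 * m + 1) * (- 3) ^ m * cyclic_skew x y"
      (is "?odd m x y")
    and "walk_sum 3 M (2 * m + 2) x y =
           3 ^ (2 * m + 1) / 2 ^ (2 * m + 2)
           + (\<Prod>i<2 * m + 2. s i) * d ^ (2 * m + 2) * (- 3) ^ m * (if x = y then - 2 else 1)"
      (is "?even m x y")
proof -
  have step: "?even m x y" if IH: "\<And>x y. x < 3 \<Longrightarrow> y < 3 \<Longrightarrow> ?odd m x y" and "x < 3" "y < 3"
    for m x y
  proof -
    define p where "p = (\<Prod>i<2 * m + 1. s i) * d ^ (2 * m + 1) * (- 3) ^ m"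
    define q :: real where "q = 3 ^ (2 * m) / 2 ^ (2 * m + 1)"
    have "walk_sum 3 M (2 * m + 2) x y =
        (\<Sum>z<3. walk_sum 3 M (2 * m + 1) x z * M (2 * m + 1) z y)"
      by simp
    also have "\<dots> = (\<Sum>z<3. (q + p * cyclic_skew x z) * (1 / 2 + s (2 * m + 1) * d * cyclic_skew z y))"
      unfolding p_def q_def using IH that M by (intro sum.cong) (auto simp del: walk_sum.simps)
    also have "\<dots> = 3 * q / 2 + p * s (2 * m + 1) * d * (if x = y then - 2 else 1)"
      unfolding sum_affine_mult cyclic_skew_sums[OF that(2,3)] by simp
    finally show ?thesis
      by (simp add: p_def q_def mult_ac)
  qed
  \<comment> \<open>The induction runs over odd lengths only, passing through the even length in
    between by \<open>step\<close>.\<close>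
  have odd: "\<forall>x<3. \<forall>y<3. ?odd m x y" for m
  proof (induction m)
    case 0
    have "walk_sum 3 M 1 x y = M 0 x y" if "x < 3" for x y
      using less_3_cases[OF that] by (auto simp: sum_lessThan_3)
    then show ?case
      by (simp add: M del: walk_sum.simps)
  next
    case (Suc m)
    define p where "p = (\<Prod>i<2 * m + 2. s i) * d ^ (2 * m + 2) * (- 3) ^ m"
    define q :: real where "q = 3 ^ (2 * m + 1) / 2 ^ (2 * m + 2)"
    have "?odd (Suc m) x y" if "x < 3" "y < 3" for x y
    proof -
      have "walk_sum 3 M (2 * Suc m + 1) x y =
          (\<Sum>z<3. walk_sum 3 M (2 * m + 2) x z * M (2 * m + 2) z y)"
        by simp
      also have "\<dots> = (\<Sum>z<3. (q + p * (if x = z then - 2 else 1)) *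
            (1 / 2 + s (2 * m + 2) * d * cyclic_skew z y))"
        unfolding p_def q_def using step Suc.IH that M
        by (intro sum.cong) (auto simp del: walk_sum.simps)
      also have "\<dots> = 3 * q / 2 + p * s (2 * m + 2) * d * (- 3) * cyclic_skew x y"
        unfolding sum_affine_mult cyclic_skew_sums[OF that] by simp
      finally show ?thesis
        by (simp add: p_def q_def mult_ac)
    qed
    then show ?case by blast
  qed
  show "?odd m x y" using odd assms by blast
  show "?even m x y" using step odd assms by blast
qed

lemma hom_density_cyclic_tournament:
  assumes "l \<ge> 3" and "even l" and S: "S \<subseteq> parcs (directed_cycle l)"
  shows "hom_density (reverse_arcs S (directed_cycle l)) 3 (cyclic_tournament d) =
           1 / 2 ^ l + (- 1) ^ (card S + l div 2) * (2 * d ^ l * 3 ^ (l div 2) / 3 ^ l)"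
proof -
  obtain m where l: "l = 2 * m + 2"
  proof -
    from \<open>even l\<close> obtain k where "l = 2 * k" by blast
    \<comment> \<open>The shift by one matches the even lengths \<open>2 * m + 2\<close> of the
      product formula.\<close>
    with \<open>l \<ge> 3\<close> show ?thesis by (intro that[of "k - 1"]) auto
  qed
  define s :: "nat \<Rightarrow> real" where "s i = (if (i, Suc i mod l) \<in> S then - 1 else 1)" for i
  define M where "M = (\<lambda>i x y. if (i, Suc i mod l) \<in> S then cyclic_tournament d $$ (y, x)
    else cyclic_tournament d $$ (x, y))"
  have M: "M i x y = 1 / 2 + s i * d * cyclic_skew x y" if "x < 3" "y < 3" for i x y
    using that by (simp add: M_def s_def cyclic_tournament_def cyclic_skew_antisym[of x y])
  have s: "(\<Prod>i<l. s i) = (- 1) ^ card S"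
    unfolding s_def by (rule prod_sign_reversed_arcs[OF S])
  have "walk_sum 3 M l x x = 3 ^ (l - 1) / 2 ^ l + (- 1) ^ card S * d ^ l * (- 3) ^ m * (- 2)"
    if "x < 3" for x
    using walk_sum_cyclic(2)[where m = m, OF M that that] s by (simp add: l del: walk_sum.simps)
  then have "(\<Sum>x<3. walk_sum 3 M l x x) =
      3 * (3 ^ (l - 1) / 2 ^ l + (- 1) ^ card S * d ^ l * (- 3) ^ m * (- 2))"
    by simp
  \<comment> \<open>Three diagonal entries \<open>-2\<close> give
    \<open>-6 * (-3)^m = 2 * (-3)^(m + 1)\<close>, and \<open>m + 1 = l div 2\<close>.\<close>
  also have "\<dots> = 3 ^ l / 2 ^ l + (- 1) ^ (card S + l div 2) * (2 * d ^ l * 3 ^ (l div 2))"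
    using power_minus[of "3::real" m] by (simp add: l power_add)
  finally show ?thesis
    using hom_density_oriented_cycle[OF assms(1) S, of 3 "cyclic_tournament d"]
    by (simp add: M_def add_divide_distrib)
qed

lemma card_parcs_reverse_arcs_directed_cycle:
  assumes "l \<ge> 3" and "S \<subseteq> parcs (directed_cycle l)"
  shows "card (parcs (reverse_arcs S (directed_cycle l))) = l"
  using bij_betw_same_card[OF bij_betw_oriented_arc[OF assms]] by simp

section \<open>Spectral radius\<close>

text \<open>The maximal row sum bound: compare both sides of the eigenvalue equation at a coordinate
  where the eigenvector has largest modulus.\<close>

lemma spectral_radius_le_entries:
  assumes A: "A \<in> carrier_mat n n" and "n > 0"
    and c: "\<And>i j. i < n \<Longrightarrow> j < n \<Longrightarrow> cmod (A $$ (i, j)) \<le> c"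
  shows "spectral_radius A \<le> real n * c"
proof -
  obtain k where k: "k \<in> spectrum A" and sr: "spectral_radius A = cmod k"
    using spectral_radius_mem_max(1)[OF A \<open>n > 0\<close>] by auto
  then obtain v where v: "v \<in> carrier_vec n" "v \<noteq> 0\<^sub>v n" and Av: "A *\<^sub>v v = k \<cdot>\<^sub>v v"
    using A by (auto simp: spectrum_def eigenvalue_def eigenvector_def)
  obtain i where i: "i < n" and i_max: "\<And>j. j < n \<Longrightarrow> cmod (v $ j) \<le> cmod (v $ i)"
  proof -
    have "finite ((\<lambda>j. cmod (v $ j)) ` {..<n})" "(\<lambda>j. cmod (v $ j)) ` {..<n} \<noteq> {}"
      using \<open>n > 0\<close> by auto
    from Max_in[OF this] Max_ge[OF this(1)] show ?thesis
      using that by force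
  qed
  have "cmod (v $ i) > 0"
  proof (rule ccontr)
    assume "\<not> cmod (v $ i) > 0"
    with i_max have "v $ j = 0" if "j < n" for j
      using that by fastforce
    with v show False by auto
  qed
  have "k * v $ i = (A *\<^sub>v v) $ i"
    using Av v i by simp
  also have "\<dots> = (\<Sum>j\<in>{0..<n}. A $$ (i, j) * v $ j)"
    using A v i by (simp add: scalar_prod_def)
  finally have "cmod k * cmod (v $ i) = cmod (\<Sum>j\<in>{0..<n}. A $$ (i, j) * v $ j)"
    by (metis norm_mult)
  also have "\<dots> \<le> (\<Sum>j\<in>{0..<n}. c * cmod (v $ i))"
  proof (rule sum_norm_le)
    fix j assume "j \<in> {0..<n}"
    then show "cmod (A $$ (i, j) * v $ j) \<le> c * cmod (v $ i)"
      \<comment> \<open>The \<open>order.trans\<close> fact supplies \<open>0 \<le> c\<close>,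
        required for multiplying the two bounds.\<close>
      using c[OF i, of j] i_max[of j] order.trans[OF norm_ge_zero c[OF i, of j]]
      unfolding norm_mult by (intro mult_mono) auto
  qed
  also have "\<dots> = real n * c * cmod (v $ i)"
    by simp
  finally show ?thesis
    using \<open>cmod (v $ i) > 0\<close> sr by simp
qed

text \<open>The exact value is \<open>sqrt 3 * d\<close>; the cruder entrywise bound already has the
  form \<epsilon> times \<open>n\<close> with \<open>n = 3\<close>.\<close>

lemma lambda_max_cyclic_tournament:
  assumes "d \<ge> 0"
  shows "lambda_max (skew_part 3 (cyclic_tournament d)) \<le> d * 3"
proof -
  let ?B = "map_mat complex_of_real (skew_part 3 (cyclic_tournament d))"
  have B: "?B \<in> carrier_mat 3 3"
    by (auto simp: skew_part_def all_ones_mat_def cyclic_tournament_def)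
  have "cmod (?B $$ (i, j)) \<le> d" if "i < 3" "j < 3" for i j
  proof -
    have "?B $$ (i, j) = complex_of_real (d * cyclic_skew i j)"
      using that by (simp add: skew_part_def all_ones_mat_def cyclic_tournament_def)
    then have "cmod (?B $$ (i, j)) = d * \<bar>cyclic_skew i j\<bar>"
      using assms by (metis abs_mult abs_of_nonneg norm_of_real)
    then show ?thesis
      using mult_left_mono[OF abs_cyclic_skew_le assms] by simp
  qed
  from spectral_radius_le_entries[OF B _ this] show ?thesis
    by (simp add: lambda_max_def mult.commute)
qed

section \<open>Arbitrarily small perturbations violating the inequalities\<close>

theorem theorem3p16:
  fixes l t :: nat and S :: "(nat \<times> nat) set" and C :: "nat pair_pre_digraph"
  assumes "l \<ge> 4" and "even l" and "t \<le> l"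
    and "S \<subseteq> parcs (directed_cycle l)" and "card S = t"
    and "C = reverse_arcs S (directed_cycle l)"
  shows "((l mod 4 = 0 \<and> even t) \<or> (l mod 4 = 2 \<and> odd t) \<longrightarrow> \<not> LTAS C) \<and>
         ((l mod 4 = 0 \<and> odd t) \<or> (l mod 4 = 2 \<and> even t) \<longrightarrow> \<not> LTS C)"
proof -
  have l: "l \<ge> 3" using assms(1) by simp
  have card_C: "card (parcs C) = l"
    using card_parcs_reverse_arcs_directed_cycle[OF l assms(4)] assms(6) by simp
  define r where "r d = 2 * d ^ l * 3 ^ (l div 2) / 3 ^ l" for d :: real
  \<comment> \<open>Three vertices suffice for every \<epsilon>: shrinking \<open>d\<close> changes
    the size of the deviation but not its sign.\<close>
  have witness: "\<exists>A. weighted_tournament 3 A \<and> lambda_max (skew_part 3 A) \<le> \<epsilon> * real 3 \<and>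
      (\<exists>c>0. hom_density C 3 A = 1 / 2 ^ card (parcs C) + (- 1) ^ (t + l div 2) * c)"
    if "\<epsilon> > 0" for \<epsilon>
  proof -
    \<comment> \<open>The bound by \<epsilon> controls the spectral radius; the bound
      \<open>1 / 2\<close> keeps the entries in the unit interval.\<close>
    define d where "d = min \<epsilon> (1 / 2)"
    have d: "0 < d" "d \<le> \<epsilon>" "d \<le> 1 / 2"
      using that by (auto simp: d_def)
    have "lambda_max (skew_part 3 (cyclic_tournament d)) \<le> \<epsilon> * real 3"
      using lambda_max_cyclic_tournament[of d] d by simp
    moreover have "r d > 0"
      using d by (simp add: r_def)
    ultimately show ?thesis
      using weighted_tournament_cyclic[of d] d card_C assms(5,6)
        hom_density_cyclic_tournament[OF l assms(2,4), of d, folded r_def]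
      by (intro exI[of _ "cyclic_tournament d"]) auto
  qed
  \<comment> \<open>Even parity makes the deviation strictly positive, odd parity strictly
    negative.\<close>
  have not_LTAS: "\<not> LTAS C" if "even (t + l div 2)"
  proof
    assume "LTAS C"
    then obtain \<epsilon> where "\<epsilon> > 0" and le: "\<And>A. weighted_tournament 3 A \<Longrightarrow>
        lambda_max (skew_part 3 A) \<le> \<epsilon> * real 3 \<Longrightarrow> hom_density C 3 A \<le> 1 / 2 ^ card (parcs C)"
      unfolding LTAS_def by (metis zero_less_numeral)
    from witness[OF \<open>\<epsilon> > 0\<close>] le that show False by force
  qed
  have not_LTS: "\<not> LTS C" if "odd (t + l div 2)"
  proof
    assume "LTS C"
    then obtain \<epsilon> where "\<epsilon> > 0" and ge: "\<And>A. weighted_tournament 3 A \<Longrightarrow>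
        lambda_max (skew_part 3 A) \<le> \<epsilon> * real 3 \<Longrightarrow> hom_density C 3 A \<ge> 1 / 2 ^ card (parcs C)"
      unfolding LTS_def by (metis zero_less_numeral)
    from witness[OF \<open>\<epsilon> > 0\<close>] ge that show False by force
  qed
  have "l mod 4 = 0 \<Longrightarrow> even (l div 2)" "l mod 4 = 2 \<Longrightarrow> odd (l div 2)"
    by presburger+
  then show ?thesis
    using not_LTAS not_LTS by auto
qed

end
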